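(* If $X$ is a metric space, then $\operatorname{ps}(X)=\log(|X|)$.
   Context: Point separating game $G_\beta(X)$ ($X$ a topological space, $\beta$ an ordinal): two players, Seeker and Hider, make $\beta$ moves. At move $\alpha<\beta$, knowing all previous moves, the Seeker chooses an open set $U_\alpha\subseteq X$, and then the Hider chooses $V_\alpha\in\{U_\alpha, X\setminus U_\alpha\}$. The outcome is $W=\bigcap_{\alpha<\beta}V_\alpha$ (with $W=X$ if $\beta=0$). The Seeker wins iff $|W|\le 1$. For a $T_0$ space $X$, $\operatorname{ps}(X)$ is the least ordinal $\beta$ such that the Seeker has a winning strategy in $G_\beta(X)$. For a cardinal $\kappa$, $\log(\kappa)=\min\{\lambda:2^\lambda\ge\kappa\}$ (minimum over cardinals). *)

theory Defs
  imports "HOL-Analysis.Analysis"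
begin

unbundle cardinal_syntax

section \<open>The point separating game\<close>

text \<open>
  Ordinals are represented by well-orders \<open>r\<close>, two of them denoting the same ordinal iff they are
  order isomorphic (\<open>=o\<close>). The ordinals below \<open>r\<close> correspond to the elements of \<open>Field r\<close>, and
  \<open>underS r \<alpha>\<close> is the set of moves played before move \<open>\<alpha>\<close>. A play is given by the functions
  \<open>U\<close> (Seeker) and \<open>V\<close> (Hider); only their values on \<open>Field r\<close> matter. The game on the ordinal 0 is
  the case \<open>r = {}\<close>.
\<close>

definition is_play ::
    "'a topology \<Rightarrow> 'b rel \<Rightarrow> ('b \<Rightarrow> 'a set) \<Rightarrow> ('b \<Rightarrow> 'a set) \<Rightarrow> bool" where
  "is_play X r U V \<longleftrightarrow>
     (\<forall>\<alpha>\<in>Field r. openin X (U \<alpha>) \<and> V \<alpha> \<in> {U \<alpha>, topspace X - U \<alpha>})"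

definition history ::
    "'b rel \<Rightarrow> ('b \<Rightarrow> 'a set) \<Rightarrow> ('b \<Rightarrow> 'a set) \<Rightarrow> 'b \<Rightarrow> 'b \<Rightarrow> 'a set \<times> 'a set" where
  "history r U V \<alpha> = restrict (\<lambda>\<gamma>. (U \<gamma>, V \<gamma>)) (underS r \<alpha>)"

definition outcome :: "'a topology \<Rightarrow> 'b rel \<Rightarrow> ('b \<Rightarrow> 'a set) \<Rightarrow> 'a set" where
  "outcome X r V = topspace X \<inter> (\<Inter>\<alpha>\<in>Field r. V \<alpha>)"

text \<open>
  A strategy of the Seeker maps the index of the current move and the history of all previous
  moves of both players to an open set.
\<close>

definition seeker_strategy ::
    "'a topology \<Rightarrow> ('b \<Rightarrow> ('b \<Rightarrow> 'a set \<times> 'a set) \<Rightarrow> 'a set) \<Rightarrow> bool" where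
  "seeker_strategy X \<sigma> \<longleftrightarrow> (\<forall>\<alpha> h. openin X (\<sigma> \<alpha> h))"

definition follows ::
    "'b rel \<Rightarrow> ('b \<Rightarrow> ('b \<Rightarrow> 'a set \<times> 'a set) \<Rightarrow> 'a set) \<Rightarrow>
      ('b \<Rightarrow> 'a set) \<Rightarrow> ('b \<Rightarrow> 'a set) \<Rightarrow> bool" where
  "follows r \<sigma> U V \<longleftrightarrow> (\<forall>\<alpha>\<in>Field r. U \<alpha> = \<sigma> \<alpha> (history r U V \<alpha>))"

definition seeker_wins :: "'a topology \<Rightarrow> 'b rel \<Rightarrow> bool" where
  "seeker_wins X r \<longleftrightarrow>
     (\<exists>\<sigma>. seeker_strategy X \<sigma> \<and>
        (\<forall>U V. is_play X r U V \<longrightarrow> follows r \<sigma> U V \<longrightarrow>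
           finite (outcome X r V) \<and> card (outcome X r V) \<le> 1))"

text \<open>
  The least ordinal is taken among well-orders on subsets of the type \<open>'a set\<close>, and is determined
  up to \<open>=o\<close>. This is no restriction: for a $T_0$ space the minimum is attained there, and it is
  minimal among well-orders on arbitrary types; see \<open>ps_least\<close> below.
\<close>

definition ps :: "'a topology \<Rightarrow> 'a set rel" where
  "ps X = (SOME r. Well_order r \<and> seeker_wins X r \<and>
             (\<forall>r' :: 'a set rel. Well_order r' \<longrightarrow> seeker_wins X r' \<longrightarrow> r \<le>o r'))"

lemma seeker_wins_ordIso:
  fixes r :: "'b rel" and r' :: "'c rel"
  assumes iso: "r =o r'" and win: "seeker_wins X r"
  shows "seeker_wins X r'"
proof -
  from iso obtain f where wo: "Well_order r" "Well_order r'" and f: "iso r r' f"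
    unfolding ordIso_def by auto
  from f have emb: "embed r r' f" and bij: "bij_betw f (Field r) (Field r')"
    unfolding iso_def by auto
  define g where "g = inv_into (Field r) f"
  have gf: "g (f \<alpha>) = \<alpha>" if "\<alpha> \<in> Field r" for \<alpha>
    using bij that unfolding g_def bij_betw_def by auto
  have Fr: "Field r' = f ` Field r"
    using bij unfolding bij_betw_def by auto
  have fu: "f \<gamma> \<in> underS r' (f \<alpha>)" if "\<alpha> \<in> Field r" "\<gamma> \<in> underS r \<alpha>" for \<alpha> \<gamma>
    using embed_underS[OF wo(1) emb that(1)] that(2) unfolding bij_betw_def by auto
  from win obtain \<sigma> where \<sigma>: "seeker_strategy X \<sigma>"
    and win\<sigma>: "\<And>U V. is_play X r U V \<Longrightarrow> follows r \<sigma> U V \<Longrightarrow>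
           finite (outcome X r V) \<and> card (outcome X r V) \<le> 1"
    unfolding seeker_wins_def by blast
  define \<tau> where "\<tau> = (\<lambda>\<alpha> h. \<sigma> (g \<alpha>) (restrict (\<lambda>\<gamma>. h (f \<gamma>)) (underS r (g \<alpha>))))"
  have "seeker_strategy X \<tau>"
    using \<sigma> unfolding seeker_strategy_def \<tau>_def by auto
  moreover have "finite (outcome X r' V) \<and> card (outcome X r' V) \<le> 1"
    if play: "is_play X r' U V" and fol: "follows r' \<tau> U V" for U V
  proof -
    have "is_play X r (U \<circ> f) (V \<circ> f)"
      using play unfolding is_play_def Fr by auto
    moreover have "follows r \<sigma> (U \<circ> f) (V \<circ> f)"
      unfolding follows_def
    proof
      fix \<alpha> assume \<alpha>: "\<alpha> \<in> Field r"
      have "U (f \<alpha>) = \<tau> (f \<alpha>) (history r' U V (f \<alpha>))"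
        using fol \<alpha> unfolding follows_def Fr by auto
      also have "\<dots> = \<sigma> \<alpha> (restrict (\<lambda>\<gamma>. history r' U V (f \<alpha>) (f \<gamma>)) (underS r \<alpha>))"
        unfolding \<tau>_def gf[OF \<alpha>] ..
      also have "restrict (\<lambda>\<gamma>. history r' U V (f \<alpha>) (f \<gamma>)) (underS r \<alpha>)
          = history r (U \<circ> f) (V \<circ> f) \<alpha>"
        unfolding history_def using fu[OF \<alpha>] by (auto simp: restrict_def fun_eq_iff)
      finally show "(U \<circ> f) \<alpha> = \<sigma> \<alpha> (history r (U \<circ> f) (V \<circ> f) \<alpha>)" by simp
    qed
    ultimately have "finite (outcome X r (V \<circ> f)) \<and> card (outcome X r (V \<circ> f)) \<le> 1"
      by (rule win\<sigma>)
    moreover have "outcome X r (V \<circ> f) = outcome X r' V"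
      unfolding outcome_def Fr by auto
    ultimately show ?thesis by simp
  qed
  ultimately show ?thesis unfolding seeker_wins_def by blast
qed

lemma seeker_wins_openin:
  fixes X :: "'a topology"
  assumes "t0_space X"
  shows "seeker_wins X |Collect (openin X)|"
proof -
  define \<sigma> :: "'a set \<Rightarrow> ('a set \<Rightarrow> 'a set \<times> 'a set) \<Rightarrow> 'a set"
    where "\<sigma> = (\<lambda>\<alpha> h. if openin X \<alpha> then \<alpha> else {})"
  have "finite (outcome X |Collect (openin X)| V) \<and> card (outcome X |Collect (openin X)| V) \<le> 1"
    if play: "is_play X |Collect (openin X)| U V" and fol: "follows |Collect (openin X)| \<sigma> U V"
    for U V
  proof -
    let ?W = "outcome X |Collect (openin X)| V"
    have V: "V A = A \<or> V A = topspace X - A" if "openin X A" for A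
      using play fol that unfolding is_play_def follows_def \<sigma>_def by (auto simp: Field_card_of)
    have eq: "x = y" if "x \<in> ?W" "y \<in> ?W" for x y
    proof (rule ccontr)
      assume "x \<noteq> y"
      moreover have "x \<in> topspace X" "y \<in> topspace X"
        using that unfolding outcome_def by auto
      ultimately obtain A where A: "openin X A" "x \<notin> A \<longleftrightarrow> y \<in> A"
        using assms unfolding t0_space_def by blast
      moreover have "x \<in> V A" "y \<in> V A"
        using that A(1) unfolding outcome_def by (auto simp: Field_card_of)
      ultimately show False using V[OF A(1)] by blast
    qed
    then have "?W = {} \<or> (\<exists>x. ?W = {x})" by blast
    then show ?thesis by auto
  qed
  moreover have "seeker_strategy X \<sigma>"
    unfolding seeker_strategy_def \<sigma>_def by auto
  ultimately show ?thesis unfolding seeker_wins_def by blast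
qed

lemma ps_least:
  fixes X :: "'a topology"
  assumes "t0_space X"
  shows "Well_order (ps X)" "seeker_wins X (ps X)"
    and "\<And>r :: 'b rel. Well_order r \<Longrightarrow> seeker_wins X r \<Longrightarrow> ps X \<le>o r"
proof -
  let ?R = "{r :: 'a set rel. Well_order r \<and> seeker_wins X r}"
  have "|Collect (openin X)| \<in> ?R"
    using seeker_wins_openin[OF assms] card_of_Well_order by blast
  then have "?R \<noteq> {}" by blast
  then have "\<exists>r\<in>?R. \<forall>r'\<in>?R. r \<le>o r'"
    by (rule exists_minim_Well_order) blast
  then have "\<exists>r :: 'a set rel. Well_order r \<and> seeker_wins X r \<and>
             (\<forall>r' :: 'a set rel. Well_order r' \<longrightarrow> seeker_wins X r' \<longrightarrow> r \<le>o r')" by blast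
  from someI_ex[OF this] have ps: "Well_order (ps X) \<and> seeker_wins X (ps X) \<and>
             (\<forall>r' :: 'a set rel. Well_order r' \<longrightarrow> seeker_wins X r' \<longrightarrow> ps X \<le>o r')"
    unfolding ps_def .
  then show wo: "Well_order (ps X)" and "seeker_wins X (ps X)" by auto
  fix r :: "'b rel"
  assume r: "Well_order r" "seeker_wins X r"
  show "ps X \<le>o r"
  proof (rule ccontr)
    assume "\<not> ps X \<le>o r"
    then have "r <o ps X" using wo r(1) by (simp add: not_ordLeq_iff_ordLess)
    then obtain p :: "'a set rel" where p: "r =o p" "p <o ps X"
      using internalize_ordLess[of r "ps X"] by blast
    have "seeker_wins X p" by (rule seeker_wins_ordIso[OF p(1) r(2)])
    moreover have "Well_order p" using p(1) unfolding ordIso_def by auto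
    ultimately have "ps X \<le>o p" using ps by blast
    with p(2) show False using not_ordLess_ordLeq by blast
  qed
qed


section \<open>The logarithm of a cardinal\<close>

text \<open>
  Cardinals are initial ordinals, i.e. well-orders \<open>\<kappa>\<close> with \<open>Card_order \<kappa>\<close>; \<open>ctwo ^c \<lambda>\<close> is cardinal
  exponentiation. As \<open>\<kappa>\<close> itself satisfies \<open>\<kappa> \<le> 2\<^sup>\<kappa>\<close>, the minimum is attained on the type
  of \<open>\<kappa>\<close>, and it is minimal among cardinals on arbitrary types; see \<open>clog_least\<close> below.
\<close>

definition clog :: "'a rel \<Rightarrow> 'a rel" where
  "clog \<kappa> = (SOME \<mu>. Card_order \<mu> \<and> \<kappa> \<le>o ctwo ^c \<mu> \<and>
               (\<forall>\<mu>' :: 'a rel. Card_order \<mu>' \<longrightarrow> \<kappa> \<le>o ctwo ^c \<mu>' \<longrightarrow> \<mu> \<le>o \<mu>'))"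

lemma clog_least:
  fixes \<kappa> :: "'a rel"
  assumes "Card_order \<kappa>"
  shows "Card_order (clog \<kappa>)" "\<kappa> \<le>o ctwo ^c clog \<kappa>"
    and "\<And>\<mu> :: 'b rel. Card_order \<mu> \<Longrightarrow> \<kappa> \<le>o ctwo ^c \<mu> \<Longrightarrow> clog \<kappa> \<le>o \<mu>"
proof -
  let ?R = "{\<mu> :: 'a rel. Card_order \<mu> \<and> \<kappa> \<le>o ctwo ^c \<mu>}"
  have "\<kappa> \<in> ?R"
    using assms ordLess_ctwo_cexp ordLess_imp_ordLeq by blast
  then have "?R \<noteq> {}" by blast
  then have "\<exists>\<mu>\<in>?R. \<forall>\<mu>'\<in>?R. \<mu> \<le>o \<mu>'"
    by (rule exists_minim_Card_order) blast
  then have "\<exists>\<mu> :: 'a rel. Card_order \<mu> \<and> \<kappa> \<le>o ctwo ^c \<mu> \<and>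
      (\<forall>\<mu>' :: 'a rel. Card_order \<mu>' \<longrightarrow> \<kappa> \<le>o ctwo ^c \<mu>' \<longrightarrow> \<mu> \<le>o \<mu>')" by blast
  from someI_ex[OF this] have cl: "Card_order (clog \<kappa>) \<and> \<kappa> \<le>o ctwo ^c clog \<kappa> \<and>
      (\<forall>\<mu>' :: 'a rel. Card_order \<mu>' \<longrightarrow> \<kappa> \<le>o ctwo ^c \<mu>' \<longrightarrow> clog \<kappa> \<le>o \<mu>')"
    unfolding clog_def .
  then show co: "Card_order (clog \<kappa>)" and "\<kappa> \<le>o ctwo ^c clog \<kappa>" by auto
  fix \<mu> :: "'b rel"
  assume \<mu>: "Card_order \<mu>" "\<kappa> \<le>o ctwo ^c \<mu>"
  show "clog \<kappa> \<le>o \<mu>"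
  proof (rule ccontr)
    assume "\<not> clog \<kappa> \<le>o \<mu>"
    then have "\<mu> <o clog \<kappa>"
      using co \<mu>(1) by (simp add: not_ordLeq_iff_ordLess card_order_on_well_order_on)
    then obtain p :: "'a rel" where p: "\<mu> =o p" "p <o clog \<kappa>"
      using internalize_ordLess[of \<mu> "clog \<kappa>"] by blast
    have cp: "Card_order p"
      using Card_order_ordIso2[OF \<mu>(1) p(1)] .
    have "ctwo ^c \<mu> =o ctwo ^c p"
      by (rule cexp_cong2[OF p(1) Card_order_ctwo \<mu>(1)])
    then have "\<kappa> \<le>o ctwo ^c p"
      using \<mu>(2) ordLeq_ordIso_trans by blast
    then have "clog \<kappa> \<le>o p" using cl cp by blast
    with p(2) show False using not_ordLess_ordLeq by blast
  qed
qed

end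

theory Submission
  imports Defs
begin

text \<open>
  A play of a winning Seeker strategy in which the Hider always keeps a given point \<open>x\<close> is determined
  by the set of moves \<open>\<alpha>\<close> with \<open>x \<in> U \<alpha>\<close>; distinct points yield distinct sets, so the space has at
  most \<open>2\<^sup>|\<^sup>r\<^sup>|\<close> points. Conversely, the Seeker may play any point separating family of open sets in an
  arbitrary order. In a metric space with at most \<open>2\<^sup>\<mu>\<close> points there is such a family with \<open>\<mu>\<close> members:
  a finite space is discrete, and in general A. H. Stone's construction (as in the proof of
  paracompactness) gives countably many disjoint open families separating points, each of which can be
  coded by subsets of \<open>\<mu>\<close>.
\<close>

section \<open>From a winning strategy to a bound on the number of points\<close>

lemma cexp_ctwo_ordIso_Pow: "ctwo ^c r =o |Pow (Field r)|"
  unfolding cexp_def ctwo_def Field_card_of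
  by (rule ordIso_symmetric[OF card_of_Pow_Func])

text \<open>The play is built by well-ordered recursion: the strategy reads only earlier moves, and
  the Hider's reply depends only on the current set and on \<open>x\<close>.\<close>

lemma exists_play_through_point:
  fixes X :: "'a topology" and r :: "'b rel"
  assumes r: "Well_order r" and strat: "seeker_strategy X \<sigma>" and x: "x \<in> topspace X"
  shows "\<exists>U V. is_play X r U V \<and> follows r \<sigma> U V \<and>
    (\<forall>\<alpha>. V \<alpha> = (if x \<in> U \<alpha> then U \<alpha> else topspace X - U \<alpha>))"
proof -
  interpret r: wo_rel r using r unfolding wo_rel_def .
  \<comment> \<open>\<open>H\<close> turns the pairs of moves before \<open>\<alpha>\<close> into
    the pair at \<open>\<alpha>\<close>. It sees \<open>u\<close> only through its restriction to
    \<open>underS r \<alpha>\<close>, which is exactly the admissibility that \<open>worec\<close>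
    requires.\<close>
  define H where "H = (\<lambda>u \<alpha>. let A = \<sigma> \<alpha> (restrict u (underS r \<alpha>))
    in (A, if x \<in> A then A else topspace X - A))"
  have "r.adm_wo H"
    unfolding r.adm_wo_def
  proof (intro allI impI)
    fix f g :: "'b \<Rightarrow> 'a set \<times> 'a set" and \<alpha>
    assume "\<forall>\<beta>\<in>underS r \<alpha>. f \<beta> = g \<beta>"
    then have "restrict f (underS r \<alpha>) = restrict g (underS r \<alpha>)"
      by (auto simp: restrict_def fun_eq_iff)
    then show "H f \<alpha> = H g \<alpha>" unfolding H_def by simp
  qed
  then have fix_eq: "r.worec H = H (r.worec H)" by (rule r.worec_fixpoint)
  define U where "U = (\<lambda>\<alpha>. fst (r.worec H \<alpha>))"
  define V where "V = (\<lambda>\<alpha>. snd (r.worec H \<alpha>))"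
  have hist: "history r U V \<alpha> = restrict (r.worec H) (underS r \<alpha>)" for \<alpha>
    unfolding history_def U_def V_def by simp
  have "(U \<alpha>, V \<alpha>) = H (r.worec H) \<alpha>" for \<alpha>
    unfolding U_def V_def using fun_cong[OF fix_eq, of \<alpha>] by simp
  then have U: "U \<alpha> = \<sigma> \<alpha> (history r U V \<alpha>)"
    and V: "V \<alpha> = (if x \<in> U \<alpha> then U \<alpha> else topspace X - U \<alpha>)" for \<alpha>
    unfolding H_def Let_def prod.inject hist by (metis, metis)
  have "is_play X r U V"
    using U V strat unfolding is_play_def seeker_strategy_def by simp
  moreover have "follows r \<sigma> U V"
    using U unfolding follows_def by simp
  ultimately show ?thesis using V by blast
qed

lemma seeker_wins_card_topspace:
  fixes X :: "'a topology" and r :: "'b rel"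
  assumes r: "Well_order r" and win: "seeker_wins X r"
  shows "|topspace X| \<le>o |Pow (Field r)|"
proof -
  from win obtain \<sigma> where \<sigma>: "seeker_strategy X \<sigma>"
    and win\<sigma>: "\<And>U V. is_play X r U V \<Longrightarrow> follows r \<sigma> U V \<Longrightarrow>
           finite (outcome X r V) \<and> card (outcome X r V) \<le> 1"
    unfolding seeker_wins_def by blast
  have "\<forall>x\<in>topspace X. \<exists>U V. is_play X r U V \<and> follows r \<sigma> U V \<and>
    (\<forall>\<alpha>. V \<alpha> = (if x \<in> U \<alpha> then U \<alpha> else topspace X - U \<alpha>))"
    using exists_play_through_point[OF r \<sigma>] by blast
  then obtain U V where play: "\<And>x. x \<in> topspace X \<Longrightarrow> is_play X r (U x) (V x)"
    and fol: "\<And>x. x \<in> topspace X \<Longrightarrow> follows r \<sigma> (U x) (V x)"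
    and V: "\<And>x \<alpha>. x \<in> topspace X \<Longrightarrow> V x \<alpha> = (if x \<in> U x \<alpha> then U x \<alpha> else topspace X - U x \<alpha>)"
    by metis
  have out: "x \<in> outcome X r (V x)" if "x \<in> topspace X" for x
    using that V unfolding outcome_def by auto
  \<comment> \<open>\<open>f x\<close> codes the Hider's answers in the play that keeps
    \<open>x\<close>.\<close>
  define f where "f x = {\<alpha> \<in> Field r. x \<in> U x \<alpha>}" for x
  have "inj_on f (topspace X)"
  proof (rule inj_onI)
    fix x y assume x: "x \<in> topspace X" and y: "y \<in> topspace X" and f: "f x = f y"
    interpret wo_rel r using r unfolding wo_rel_def .
    \<comment> \<open>Equal histories make the strategy choose equal sets, and
      \<open>f x = f y\<close> makes the Hider's answers to them agree. The two plays coincide, so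
      \<open>x\<close> and \<open>y\<close> survive in one common outcome.\<close>
    have same: "\<alpha> \<in> Field r \<longrightarrow> U x \<alpha> = U y \<alpha> \<and> V x \<alpha> = V y \<alpha>" for \<alpha>
    proof (induction \<alpha> rule: well_order_induct, rule impI)
      fix \<alpha> assume IH: "\<forall>\<beta>. \<beta> \<noteq> \<alpha> \<and> (\<beta>, \<alpha>) \<in> r \<longrightarrow>
        (\<beta> \<in> Field r \<longrightarrow> U x \<beta> = U y \<beta> \<and> V x \<beta> = V y \<beta>)" and \<alpha>: "\<alpha> \<in> Field r"
      have "history r (U x) (V x) \<alpha> = history r (U y) (V y) \<alpha>"
        using IH unfolding history_def by (auto simp: restrict_def fun_eq_iff underS_def Field_def)
      then have "U x \<alpha> = U y \<alpha>"
        using fol[OF x] fol[OF y] \<alpha> unfolding follows_def by simp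
      moreover have "x \<in> U x \<alpha> \<longleftrightarrow> y \<in> U y \<alpha>"
        using f \<alpha> unfolding f_def by blast
      ultimately show "U x \<alpha> = U y \<alpha> \<and> V x \<alpha> = V y \<alpha>"
        using V[OF x] V[OF y] by simp
    qed
    then have "outcome X r (V x) = outcome X r (V y)"
      unfolding outcome_def by auto
    then have "x \<in> outcome X r (V x)" "y \<in> outcome X r (V x)"
      using out x y by auto
    with win\<sigma>[OF play[OF x] fol[OF x]] show "x = y"
      by (auto simp: card_le_Suc0_iff_eq)
  qed
  moreover have "f ` topspace X \<subseteq> Pow (Field r)"
    unfolding f_def by blast
  ultimately show ?thesis using card_of_ordLeq by blast
qed

section \<open>Separating open families as winning strategies\<close>

lemma seeker_wins_separating_family:
  fixes X :: "'a topology" and r :: "'b rel"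
  assumes op: "\<And>\<alpha>. \<alpha> \<in> Field r \<Longrightarrow> openin X (g \<alpha>)"
    and sep: "\<And>x y. x \<in> topspace X \<Longrightarrow> y \<in> topspace X \<Longrightarrow> x \<noteq> y \<Longrightarrow>
      \<exists>\<alpha>\<in>Field r. x \<in> g \<alpha> \<longleftrightarrow> y \<notin> g \<alpha>"
  shows "seeker_wins X r"
proof -
  \<comment> \<open>A strategy must return an open set at every index, hence the default
    \<open>{}\<close> off \<open>Field r\<close>.\<close>
  define \<sigma> :: "'b \<Rightarrow> ('b \<Rightarrow> 'a set \<times> 'a set) \<Rightarrow> 'a set"
    where "\<sigma> = (\<lambda>\<alpha> h. if \<alpha> \<in> Field r then g \<alpha> else {})"
  have "seeker_strategy X \<sigma>"
    using op unfolding seeker_strategy_def \<sigma>_def by simp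
  moreover have "finite (outcome X r V) \<and> card (outcome X r V) \<le> 1"
    if play: "is_play X r U V" and fol: "follows r \<sigma> U V" for U V
  proof -
    have V: "V \<alpha> = g \<alpha> \<or> V \<alpha> = topspace X - g \<alpha>" if "\<alpha> \<in> Field r" for \<alpha>
      using play fol that unfolding is_play_def follows_def \<sigma>_def by auto
    have "x = y" if "x \<in> outcome X r V" "y \<in> outcome X r V" for x y
      using that sep[of x y] V unfolding outcome_def by blast
    then have "outcome X r V = {} \<or> (\<exists>x. outcome X r V = {x})" by blast
    then show ?thesis by auto
  qed
  ultimately show ?thesis unfolding seeker_wins_def by blast
qed

section \<open>Stone's disjoint open cells and a small separating family\<close>

context Metric_space
begin

text \<open>
  The members of Stone's disjoint open refinement of the cover by the balls of radius \<open>\<epsilon>\<close>, whose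
  centers are well-ordered by \<open>w\<close>.
\<close>

definition stone_cell :: "'a rel \<Rightarrow> real \<Rightarrow> real \<Rightarrow> 'a \<Rightarrow> 'a set" where
  "stone_cell w \<epsilon> \<delta> a = (\<Union>x \<in> {x \<in> M. mball x \<delta> \<subseteq> mball a \<epsilon> \<and>
     (\<forall>b\<in>underS w a. x \<notin> mball b \<epsilon>)}. mball x (\<delta> / 2))"

lemma openin_stone_cell: "openin mtopology (stone_cell w \<epsilon> \<delta> a)"
  unfolding stone_cell_def by auto

lemma stone_cell_subset: "\<delta> > 0 \<Longrightarrow> stone_cell w \<epsilon> \<delta> a \<subseteq> mball a \<epsilon>"
  unfolding stone_cell_def by (auto simp: subset_iff)

text \<open>This is why the cells use radius \<open>\<delta> / 2\<close>: if balls around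
  \<open>x\<close> and \<open>y\<close> meet, then \<open>d x y < \<delta>\<close>. So
  \<open>y\<close> lies in \<open>mball x \<delta>\<close>, hence in the earlier ball around
  \<open>a\<close>, which the points defining the cell of \<open>b\<close> must avoid.\<close>

lemma stone_cell_disjoint_aux:
  assumes "a \<in> underS w b"
  shows "stone_cell w \<epsilon> \<delta> a \<inter> stone_cell w \<epsilon> \<delta> b = {}"
proof (rule ccontr)
  assume "\<not> ?thesis"
  then obtain z x y where z: "z \<in> mball x (\<delta> / 2)" "z \<in> mball y (\<delta> / 2)"
    and x: "mball x \<delta> \<subseteq> mball a \<epsilon>" and y: "\<forall>c\<in>underS w b. y \<notin> mball c \<epsilon>"
    unfolding stone_cell_def by blast
  have "y \<in> mball x \<delta>"
    using z triangle[of x z y] commute[of z y] by auto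
  with x y assms show False by blast
qed

lemma stone_cell_disjoint:
  assumes w: "Well_order w" and a: "a \<in> Field w" and b: "b \<in> Field w"
    and z: "z \<in> stone_cell w \<epsilon> \<delta> a" "z \<in> stone_cell w \<epsilon> \<delta> b"
  shows "a = b"
proof (rule ccontr)
  assume "a \<noteq> b"
  moreover have "Total w" using w unfolding well_order_on_def linear_order_on_def by simp
  ultimately have "a \<in> underS w b \<or> b \<in> underS w a"
    using a b unfolding total_on_def underS_def by auto
  then show False using stone_cell_disjoint_aux z by blast
qed

text \<open>Take the \<open>w\<close>-least center whose \<open>\<epsilon>\<close>-ball contains
  \<open>x\<close>; since this ball is open, it contains a ball around \<open>x\<close> of some
  radius \<open>1 / (m + 1)\<close>.\<close>

lemma stone_cells_cover:
  assumes w: "Well_order w" and Fw: "Field w = M" and x: "x \<in> M" and "\<epsilon> > 0"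
  shows "\<exists>a\<in>M. \<exists>m. x \<in> stone_cell w \<epsilon> (inverse (real (Suc m))) a"
proof -
  interpret w: wo_rel w using w unfolding wo_rel_def .
  let ?B = "{a \<in> M. x \<in> mball a \<epsilon>}"
  define a where "a = w.minim ?B"
  have B: "?B \<subseteq> Field w" "?B \<noteq> {}" using Fw x \<open>\<epsilon> > 0\<close> by auto
  then have a: "a \<in> M" "x \<in> mball a \<epsilon>"
    using w.minim_in[of ?B] unfolding a_def by auto
  have least: "x \<notin> mball b \<epsilon>" if "b \<in> underS w a" for b
  proof
    assume xb: "x \<in> mball b \<epsilon>"
    have "b \<in> Field w" using that unfolding underS_def Field_def by blast
    with xb Fw have "(a, b) \<in> w"
      using w.minim_least[of ?B b] B unfolding a_def by simp
    with that show False
      using w.ANTISYM unfolding underS_def antisym_def by blast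
  qed
  have "openin mtopology (mball a \<epsilon>)" by simp
  then obtain e where e: "e > 0" "mball x e \<subseteq> mball a \<epsilon>"
    using a unfolding openin_mtopology by blast
  from reals_Archimedean[OF \<open>e > 0\<close>] obtain m where m: "inverse (real (Suc m)) < e" ..
  have "mball x (inverse (real (Suc m))) \<subseteq> mball a \<epsilon>"
    using e(2) mball_subset_concentric[of "inverse (real (Suc m))" e x] m by force
  moreover have "x \<in> mball x (inverse (real (Suc m)) / 2)" using x by simp
  ultimately show ?thesis
    using a(1) x least unfolding stone_cell_def by blast
qed

text \<open>Each center \<open>a\<close> is coded by the subset \<open>f a\<close> of
  \<open>S\<close>. For each pair \<open>(n, m)\<close> of scales, the index \<open>None\<close>
  gives the union of all cells, and \<open>Some s\<close> the union of the cells whose code contains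
  \<open>s\<close>.\<close>

lemma separating_open_family:
  assumes f: "inj_on f M" "f ` M \<subseteq> Pow S"
  obtains G :: "(nat \<times> nat) \<times> 'b option \<Rightarrow> 'a set" where
    "\<And>t. openin mtopology (G t)"
    "\<And>x y. x \<in> M \<Longrightarrow> y \<in> M \<Longrightarrow> x \<noteq> y \<Longrightarrow>
      \<exists>t\<in>UNIV \<times> insert None (Some ` S). x \<in> G t \<longleftrightarrow> y \<notin> G t"
proof -
  obtain w :: "'a rel" where w: "Well_order w" and Fw: "Field w = M"
    using card_of_Well_order[of M] Field_card_of[of M] by blast
  define E where "E = (\<lambda>(n, m) a. stone_cell w (inverse (real (Suc n))) (inverse (real (Suc m))) a)"
  define G where "G = (\<lambda>(p, i). \<Union>a\<in>{a \<in> M. case i of None \<Rightarrow> True | Some s \<Rightarrow> s \<in> f a}. E p a)"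
  have "openin mtopology (G t)" for t
    unfolding G_def E_def by (auto simp: openin_stone_cell split: prod.split)
  moreover have "\<exists>t\<in>UNIV \<times> insert None (Some ` S). x \<in> G t \<longleftrightarrow> y \<notin> G t"
    if x: "x \<in> M" and y: "y \<in> M" and "x \<noteq> y" for x y
  proof -
    have "d x y / 2 > 0" using that by simp
    \<comment> \<open>A cell at scale \<open>n\<close> lies in a ball of radius less than
      \<open>d x y / 2\<close>, so it cannot contain both \<open>x\<close> and
      \<open>y\<close>.\<close>
    from reals_Archimedean[OF this] obtain n where n: "inverse (real (Suc n)) < d x y / 2" ..
    obtain a m where a: "a \<in> M" and "x \<in> stone_cell w (inverse (real (Suc n))) (inverse (real (Suc m))) a"
      using stone_cells_cover[OF w Fw x, of "inverse (real (Suc n))"] by auto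
    then have xa: "x \<in> E (n, m) a" unfolding E_def by simp
    have ball: "E (n, m) a \<subseteq> mball a (inverse (real (Suc n)))"
      unfolding E_def by (simp add: stone_cell_subset)
    have ya: "y \<notin> E (n, m) a"
    proof
      assume "y \<in> E (n, m) a"
      then have "d a x < inverse (real (Suc n))" "d a y < inverse (real (Suc n))"
        using xa ball by auto
      then show False
        using n triangle[of x a y] commute[of x a] a x y by linarith
    qed
    have disj: "b = c" if "b \<in> M" "c \<in> M" "z \<in> E (n, m) b" "z \<in> E (n, m) c" for b c z
      using stone_cell_disjoint[OF w] that Fw unfolding E_def by auto
    have G_None: "z \<in> G ((n, m), None) \<longleftrightarrow> (\<exists>c\<in>M. z \<in> E (n, m) c)" for z
      unfolding G_def by auto
    \<comment> \<open>By disjointness the cell containing \<open>z\<close> is unique, so its code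
      alone decides membership.\<close>
    have G_Some: "z \<in> G ((n, m), Some s) \<longleftrightarrow> s \<in> f c" if "c \<in> M" "z \<in> E (n, m) c" for z c s
    proof -
      have "z \<in> G ((n, m), Some s) \<longleftrightarrow> (\<exists>b\<in>M. s \<in> f b \<and> z \<in> E (n, m) b)"
        unfolding G_def by auto
      then show ?thesis using that disj by blast
    qed
    show ?thesis
    \<comment> \<open>Either \<open>y\<close> misses the union of all cells, which contains
      \<open>x\<close>, or \<open>x\<close> and \<open>y\<close> lie in cells with different codes
      and some \<open>s\<close> tells these codes apart.\<close>
    proof (cases "\<exists>b\<in>M. y \<in> E (n, m) b")
      case False
      then have "x \<in> G ((n, m), None) \<longleftrightarrow> y \<notin> G ((n, m), None)"
        using a xa G_None by blast
      then show ?thesis by blast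
    next
      case True
      then obtain b where b: "b \<in> M" "y \<in> E (n, m) b" by blast
      with ya have "a \<noteq> b" by blast
      then have "f a \<noteq> f b" using f(1) a b(1) by (auto dest: inj_onD)
      then obtain s where s: "s \<in> f a \<longleftrightarrow> s \<notin> f b" by blast
      then have "s \<in> S" using f(2) a b(1) by blast
      moreover have "x \<in> G ((n, m), Some s) \<longleftrightarrow> y \<notin> G ((n, m), Some s)"
        using s G_Some[OF a xa] G_Some[OF b] by simp
      ultimately show ?thesis by blast
    qed
  qed
  ultimately show thesis by (rule that)
qed

section \<open>A win for the Seeker in \<open>\<mu>\<close> moves\<close>

lemma finite_imp_openin_mtopology:
  assumes "finite M" "A \<subseteq> M"
  shows "openin mtopology A"
proof -
  have "closedin mtopology (M - A)"
    using assms by (intro closedin_Hausdorff_finite Hausdorff_space_mtopology) auto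
  then have "openin mtopology (M - (M - A))"
    using openin_closedin_eq by fastforce
  moreover have "M - (M - A) = A" using assms by blast
  ultimately show ?thesis by simp
qed

text \<open>For infinite \<open>\<mu>\<close>, the countably many scales are absorbed by
  \<open>\<mu>\<close>. For finite \<open>\<mu>\<close> they are not, but then \<open>M\<close> is
  finite and discrete, so the coordinates of the code \<open>f\<close> are themselves open
  sets.\<close>

lemma seeker_wins_mtopology:
  fixes \<mu> :: "'b rel"
  assumes \<mu>: "Card_order \<mu>" and le: "|M| \<le>o |Pow (Field \<mu>)|"
  shows "seeker_wins mtopology \<mu>"
proof -
  obtain f where f: "inj_on f M" "f ` M \<subseteq> Pow (Field \<mu>)"
    using le card_of_ordLeq by metis
  show ?thesis
  proof (cases "finite (Field \<mu>)")
    case True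
    then have "finite M" using card_of_ordLeq_finite[OF le] by simp
    show ?thesis
    proof (rule seeker_wins_separating_family[where g = "\<lambda>s. {x \<in> M. s \<in> f x}"])
      show "openin mtopology {x \<in> M. s \<in> f x}" for s
        by (rule finite_imp_openin_mtopology[OF \<open>finite M\<close>]) blast
      fix x y assume "x \<in> topspace mtopology" "y \<in> topspace mtopology" "x \<noteq> y"
      then have xy: "x \<in> M" "y \<in> M" and "f x \<noteq> f y"
        using f(1) by (auto dest: inj_onD)
      then obtain s where s: "s \<in> f x \<longleftrightarrow> s \<notin> f y" by blast
      moreover have "s \<in> Field \<mu>" using s f(2) xy by blast
      ultimately show "\<exists>s\<in>Field \<mu>. x \<in> {x \<in> M. s \<in> f x} \<longleftrightarrow> y \<notin> {x \<in> M. s \<in> f x}"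
        using xy by blast
    qed
  next
    case False
    let ?T = "(UNIV :: (nat \<times> nat) set) \<times> insert None (Some ` Field \<mu>)"
    have inf: "infinite (Field \<mu>)" by fact
    have "|UNIV :: nat set| \<le>o |Field \<mu>|"
      using inf infinite_iff_card_of_nat by blast
    moreover have "|UNIV :: (nat \<times> nat) set| =o |UNIV :: nat set|"
      using card_of_Times_same_infinite[of "UNIV :: nat set"] by simp
    ultimately have 1: "|UNIV :: (nat \<times> nat) set| \<le>o |Field \<mu>|"
      using ordIso_ordLeq_trans by blast
    have "|{None :: 'b option}| \<le>o |Field \<mu>|"
      using inf by (intro card_of_singl_ordLeq) auto
    then have "|{None} \<union> Some ` Field \<mu>| \<le>o |Field \<mu>|"
      using inf by (intro card_of_Un_ordLeq_infinite_Field card_of_image card_of_Card_order)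
        (auto simp: Field_card_of)
    then have 2: "|insert None (Some ` Field \<mu>)| \<le>o |Field \<mu>|" by simp
    have "|?T| \<le>o |Field \<mu>|"
      by (rule card_of_Times_ordLeq_infinite_Field[of "|Field \<mu>|"])
        (use inf 1 2 card_of_Card_order in \<open>auto simp: Field_card_of\<close>)
    moreover have "?T \<noteq> {}" by auto
    \<comment> \<open>A surjection onto the index set is enough: playing a set twice does no
      harm.\<close>
    ultimately obtain h where h: "h ` Field \<mu> = ?T"
      using card_of_ordLeq2 by metis
    obtain G :: "(nat \<times> nat) \<times> 'b option \<Rightarrow> 'a set" where
      G: "\<And>t. openin mtopology (G t)"
      "\<And>x y. x \<in> M \<Longrightarrow> y \<in> M \<Longrightarrow> x \<noteq> y \<Longrightarrow> \<exists>t\<in>?T. x \<in> G t \<longleftrightarrow> y \<notin> G t"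
      using separating_open_family[OF f] by blast
    show ?thesis
    proof (rule seeker_wins_separating_family[where g = "\<lambda>s. G (h s)"])
      show "openin mtopology (G (h s))" for s by (rule G(1))
      fix x y assume "x \<in> topspace mtopology" "y \<in> topspace mtopology" "x \<noteq> y"
      then show "\<exists>s\<in>Field \<mu>. x \<in> G (h s) \<longleftrightarrow> y \<notin> G (h s)"
        using G(2)[of x y] unfolding h[symmetric] by auto
    qed
  qed
qed

end

section \<open>Comparison of \<open>ps\<close> with the logarithm\<close>

theorem corollary6p2:
  fixes M :: "'a set" and d :: "'a \<Rightarrow> 'a \<Rightarrow> real"
  assumes "Metric_space M d"
  shows "ps (Metric_space.mtopology M d) =o clog |M|"
proof -
  interpret Metric_space M d by fact
  let ?X = "mtopology" and ?\<mu> = "clog |M|"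
  have t0: "t0_space ?X"
    using Hausdorff_space_mtopology Hausdorff_imp_t1_space t1_imp_t0_space by blast
  note wo = ps_least(1)[OF t0]
  note cl = clog_least[OF card_of_Card_order[of M]]
  have "|M| \<le>o |Pow (Field ?\<mu>)|"
    using cl(2) cexp_ctwo_ordIso_Pow ordLeq_ordIso_trans by blast
  then have "seeker_wins ?X ?\<mu>" by (rule seeker_wins_mtopology[OF cl(1)])
  then have le: "ps ?X \<le>o ?\<mu>"
    using ps_least(3)[OF t0 card_order_on_well_order_on[OF cl(1)]] by blast
  \<comment> \<open>\<open>ps\<close> is a priori only an ordinal, whereas minimality of the
    logarithm concerns cardinals. The lower bound therefore passes through the cardinality of
    \<open>ps\<close>, which is at most \<open>ps\<close> as an ordinal.\<close>
  let ?\<nu> = "|Field (ps ?X)|"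
  have "|M| \<le>o |Pow (Field ?\<nu>)|"
    using seeker_wins_card_topspace[OF wo ps_least(2)[OF t0]] by (simp add: Field_card_of)
  then have "|M| \<le>o ctwo ^c ?\<nu>"
    using cexp_ctwo_ordIso_Pow[of ?\<nu>] ordIso_symmetric ordLeq_ordIso_trans by blast
  then have "?\<mu> \<le>o ?\<nu>" by (rule cl(3)[OF card_of_Card_order])
  moreover have "?\<nu> \<le>o ps ?X"
    using card_of_least[OF wo] .
  ultimately show ?thesis
    using le ordLeq_transitive ordIso_iff_ordLeq by blast
qed

end
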